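(* Let $u,v\in\mathbb{N}$ and let $A$ be a $u\times v$ matrix with entries from $\mathbb{N}\cup\{0\}$ such that no row of $A$ is zero. Let $S\subseteq(0,\infty)$ be a dense subsemigroup of $([0,\infty),+)$. Suppose that (1) for each central set near zero $C$ in $S$ there exists $\vec{x}\in S^v$ such that $A\vec{x}\in C^u$, and (2) for each $\epsilon>0$ and each $s\in S\cap(0,\epsilon)$ there exists $\vec{x}\in(S\cap(0,\epsilon))^v$ such that $A\vec{x}=\overline{s}$. Then for every piecewise syndetic set near zero $B$ in $S$, the set $\{\vec{x}\in S^v:A\vec{x}\in B^u\}\subseteq S^v$ is piecewise syndetic near zero.
   Context: $\overline{s}=(s,\dots,s)$. $[0,\infty)^k$ carries the Euclidean topology and coordinatewise addition; for $S^v$, "near zero" means near $\overline0$. For a semigroup $S'$ (here $S$ or $S^v$) with $e=\overline 0$ and $\tau_e$ its neighborhoods: $\beta S'$ is the set of ultrafilters on $S'$ with $p+q=\{X:\{s:-s+X\in q\}\in p\}$, $-t+X=\{y:t+y\in X\}$; $0_{S'}^*=\{p\in\beta S':U\cap S'\in p\ \forall U\in\tau_e\}$ with smallest ideal $K(0_{S'}^* )$. $C\subseteq S'$ is central near zero if $C\in p$ for some idempotent $p\in K(0_{S'}^* )$. $X\subseteq S'$ is piecewise syndetic near zero if, for a decreasing countable local base $\langle W_n\rangle$ at $e$, there are finite nonempty $F_n\subseteq W_n\cap S'$ and $V_n\in\tau_e$ with $V_n\subseteq W_n$ such that for every finite nonempty $G\subseteq S'$ and $O\in\tau_e$ there is $x\in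 O\cap S'$ with $(G\cap V_n)+x\subseteq\bigcup_{t\in F_n}(-t+X)$ for every $n$. *)

theory Defs
  imports "HOL-Analysis.Analysis"
begin

text \<open>
  For an ordered Euclidean space, \<^term>\<open>{0..}\<close> is the nonnegative orthant: \<open>[0,\<infinity>)\<close> for
  \<^typ>\<open>real\<close> and \<open>[0,\<infinity>)^k\<close> for \<^typ>\<open>real ^ 'k\<close>. All notions below therefore apply both to
  \<open>S\<close> and to \<open>S^v\<close>; the parameter \<open>S\<close> is the carrier of the subsemigroup.
\<close>

definition nbhds_zero :: "'a::ordered_euclidean_space set set" where
  "nbhds_zero = {U. U \<subseteq> {0..} \<and> (\<exists>O'. openin (top_of_set {0..}) O' \<and> 0 \<in> O' \<and> O' \<subseteq> U)}"

definition dense_subsemigroup :: "'a::ordered_euclidean_space set \<Rightarrow> bool" where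
  "dense_subsemigroup S \<longleftrightarrow>
     S \<subseteq> {0..} \<and> (\<forall>x\<in>S. \<forall>y\<in>S. x + y \<in> S) \<and> top_of_set {0..} closure_of S = {0..}"

definition shift :: "'a::plus set \<Rightarrow> 'a \<Rightarrow> 'a set \<Rightarrow> 'a set" where
  "shift S t X = {y \<in> S. t + y \<in> X}"  \<comment> \<open>\<open>-t + X\<close>\<close>

definition ultrafilter_on :: "'a set \<Rightarrow> 'a set set \<Rightarrow> bool" where
  "ultrafilter_on S p \<longleftrightarrow>
     p \<subseteq> Pow S \<and> S \<in> p \<and> {} \<notin> p \<and>
     (\<forall>X\<in>p. \<forall>Y. X \<subseteq> Y \<and> Y \<subseteq> S \<longrightarrow> Y \<in> p) \<and>
     (\<forall>X\<in>p. \<forall>Y\<in>p. X \<inter> Y \<in> p) \<and>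
     (\<forall>X. X \<subseteq> S \<longrightarrow> X \<in> p \<or> S - X \<in> p)"

definition ultra_sum :: "'a::plus set \<Rightarrow> 'a set set \<Rightarrow> 'a set set \<Rightarrow> 'a set set" where
  "ultra_sum S p q = {X. X \<subseteq> S \<and> {s \<in> S. shift S s X \<in> q} \<in> p}"

definition zero_star :: "'a::ordered_euclidean_space set \<Rightarrow> 'a set set set" where
  "zero_star S = {p. ultrafilter_on S p \<and> (\<forall>U\<in>nbhds_zero. U \<inter> S \<in> p)}"

definition ideal_of_zero_star ::
    "'a::ordered_euclidean_space set \<Rightarrow> 'a set set set \<Rightarrow> bool" where
  "ideal_of_zero_star S I \<longleftrightarrow>
     I \<noteq> {} \<and> I \<subseteq> zero_star S \<and>
     (\<forall>p\<in>I. \<forall>q\<in>zero_star S. ultra_sum S p q \<in> I \<and> ultra_sum S q p \<in> I)"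

text \<open>
  The smallest ideal, if it exists, is the intersection of all (two-sided) ideals.
\<close>

definition K_zero_star :: "'a::ordered_euclidean_space set \<Rightarrow> 'a set set set" where
  "K_zero_star S = \<Inter> {I. ideal_of_zero_star S I}"

definition central_near_zero :: "'a::ordered_euclidean_space set \<Rightarrow> 'a set \<Rightarrow> bool" where
  "central_near_zero S C \<longleftrightarrow>
     C \<subseteq> S \<and> (\<exists>p\<in>K_zero_star S. p \<in> zero_star S \<and> ultra_sum S p p = p \<and> C \<in> p)"

definition local_base_zero :: "(nat \<Rightarrow> 'a::ordered_euclidean_space set) \<Rightarrow> bool" where
  "local_base_zero W \<longleftrightarrow>
     decseq W \<and> (\<forall>n. W n \<in> nbhds_zero) \<and> (\<forall>U\<in>nbhds_zero. \<exists>n. W n \<subseteq> U)"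

text \<open>
  The choice of the base \<open>W\<close> is immaterial: given another base \<open>W'\<close>, choose
  \<open>m n\<close> with \<open>W (m n) \<subseteq> W' n\<close> and use \<open>F (m n)\<close> and \<open>V (m n)\<close>.
\<close>

definition piecewise_syndetic_near_zero ::
    "'a::ordered_euclidean_space set \<Rightarrow> 'a set \<Rightarrow> bool" where
  "piecewise_syndetic_near_zero S X \<longleftrightarrow>
     X \<subseteq> S \<and>
     (\<exists>W. local_base_zero W \<and>
       (\<exists>F V. (\<forall>n. finite (F n) \<and> F n \<noteq> {} \<and> F n \<subseteq> W n \<inter> S) \<and>
              (\<forall>n. V n \<in> nbhds_zero \<and> V n \<subseteq> W n) \<and>
              (\<forall>G O'. finite G \<and> G \<noteq> {} \<and> G \<subseteq> S \<and> O' \<in> nbhds_zero \<longrightarrow>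
                 (\<exists>x \<in> O' \<inter> S. \<forall>n.
                    (\<lambda>g. g + x) ` (G \<inter> V n) \<subseteq> (\<Union>t\<in>F n. shift S t X)))))"

definition cart_power :: "'a set \<Rightarrow> ('a ^ 'n) set" where
  "cart_power S = {x. \<forall>i. x $ i \<in> S}"

end

(*
  An ultrafilter is a predicate on sets, so the ultrafilters form a closed subset of a product of
  two-point spaces and p |-> p + q is coordinatewise a projection. A set is piecewise syndetic
  near zero iff it belongs to an ultrafilter p in a minimal left ideal of the compact right
  topological semigroup 0* of ultrafilters near zero.

  Given such a p with B in p, hypothesis (2) yields an ultrafilter q near zero on S^v that every row
  of A maps to p. The semigroup near zero of S^v plus q contains a minimal left ideal, which has an
  idempotent f; the i-th row maps f to an idempotent of 0* + p, hence to a right identity of 0* + p.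
  So q + f lies in a minimal left ideal and every row still maps it to p.
*)
theory Submission
  imports Defs
begin

section \<open>Compact right topological semigroups\<close>

text \<open>Zorn's lemma with compactness: a chain of nonempty compact sets has nonempty
  intersection, and \<open>P\<close> passes to it. Below, \<open>P\<close> is closure under left
  translation or under addition.\<close>

lemma compact_minimal_set:
  fixes K :: "'a::t2_space set"
  assumes "compact K" "K \<noteq> {}" "P K"
    and Inter: "\<And>\<C>. \<C> \<noteq> {} \<Longrightarrow> (\<And>C. C \<in> \<C> \<Longrightarrow> P C) \<Longrightarrow> P (\<Inter>\<C>)"
  obtains M where "M \<subseteq> K" "compact M" "M \<noteq> {}" "P M"
    "\<And>N. N \<subseteq> M \<Longrightarrow> compact N \<Longrightarrow> N \<noteq> {} \<Longrightarrow> P N \<Longrightarrow> N = M"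
proof -
  \<comment> \<open>Complements turn the search for a minimal set into one for a maximal set, the
    form that \<open>subset_Zorn_nonempty\<close> provides.\<close>
  define \<A> where "\<A> = uminus ` {C. C \<subseteq> K \<and> compact C \<and> C \<noteq> {} \<and> P C}"
  have mem: "X \<in> \<A> \<longleftrightarrow> - X \<subseteq> K \<and> compact (- X) \<and> - X \<noteq> {} \<and> P (- X)" for X
  proof -
    have "X \<in> uminus ` \<B> \<longleftrightarrow> - X \<in> \<B>" for \<B> :: "'a set set"
      by (metis double_complement imageE image_eqI)
    then show ?thesis by (simp add: \<A>_def)
  qed
  have "\<exists>M\<in>\<A>. \<forall>X\<in>\<A>. M \<subseteq> X \<longrightarrow> X = M"
  proof (rule subset_Zorn_nonempty)
    show "\<A> \<noteq> {}" using assms(1-3) by (auto simp: \<A>_def)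
  next
    fix \<C> assume "\<C> \<noteq> {}" and chain: "subset.chain \<A> \<C>"
    then obtain C0 where C0: "C0 \<in> \<C>" by auto
    have \<C>: "- C \<subseteq> K" "compact (- C)" "- C \<noteq> {}" "P (- C)" if "C \<in> \<C>" for C
    proof -
      have "C \<in> \<A>" using chain that unfolding subset.chain_def by blast
      then show "- C \<subseteq> K" "compact (- C)" "- C \<noteq> {}" "P (- C)" unfolding mem by simp_all
    qed
    have eq: "- \<Union>\<C> = \<Inter>(uminus ` \<C>)" by auto
    have "- C0 \<inter> \<Inter>(uminus ` \<C>) \<noteq> {}"
    proof (rule compact_imp_fip)
      show "compact (- C0)" using \<C> C0 by auto
      show "closed T" if "T \<in> uminus ` \<C>" for T
        using that \<C>(2) compact_imp_closed by auto
      fix \<F> assume fin: "finite \<F>" and sub: "\<F> \<subseteq> uminus ` \<C>"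
      let ?G = "insert (- C0) \<F>"
      have G: "?G \<subseteq> uminus ` \<C>" using sub C0 by auto
      \<comment> \<open>In a chain, a minimal member of a finite subfamily is its least member, so
        the finite intersection contains the nonempty set \<open>m\<close>.\<close>
      obtain m where m: "m \<in> ?G" "\<forall>b\<in>?G. b \<subseteq> m \<longrightarrow> m = b"
        using finite_has_minimal[of ?G] fin by auto
      have le: "m \<subseteq> b" if b: "b \<in> ?G" for b
      proof -
        obtain c where c: "c \<in> \<C>" "m = - c" using m(1) G by (meson imageE subsetD)
        obtain d where d: "d \<in> \<C>" "b = - d" using b G by (meson imageE subsetD)
        have "c \<subseteq> d \<or> d \<subseteq> c"
          using chain c d unfolding subset.chain_def by blast
        then show ?thesis
        proof
          assume "d \<subseteq> c"
          then show ?thesis using c d by auto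
        next
          assume "c \<subseteq> d"
          then show ?thesis using m(2) b c d by auto
        qed
      qed
      have "m \<subseteq> - C0 \<inter> \<Inter>\<F>" using le by auto
      moreover have "m \<noteq> {}"
      proof -
        obtain c where "c \<in> \<C>" "m = - c" using m(1) G by (meson imageE subsetD)
        then show ?thesis using \<C>(3) by metis
      qed
      ultimately show "- C0 \<inter> \<Inter>\<F> \<noteq> {}" by (metis bot.extremum_uniqueI)
    qed
    then have "- \<Union>\<C> \<noteq> {}" unfolding eq by auto
    moreover have "compact (- \<Union>\<C>)"
    proof -
      have "closed (\<Inter>(uminus ` \<C>))" using \<C>(2) compact_imp_closed by (intro closed_Inter) auto
      then have "compact (- C0 \<inter> \<Inter>(uminus ` \<C>))" using \<C>(2)[OF C0] by (rule compact_Int_closed[rotated])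
      moreover have "- C0 \<inter> \<Inter>(uminus ` \<C>) = - \<Union>\<C>" using C0 by auto
      ultimately show ?thesis by simp
    qed
    moreover have "P (- \<Union>\<C>)" unfolding eq
      by (rule Inter) (use \<C> C0 in auto)
    moreover have "- \<Union>\<C> \<subseteq> K" using \<C>(1)[OF C0] C0 by auto
    ultimately show "\<Union>\<C> \<in> \<A>" unfolding mem by simp
  qed
  then obtain X where X: "X \<in> \<A>" "\<And>Y. Y \<in> \<A> \<Longrightarrow> X \<subseteq> Y \<Longrightarrow> Y = X" by blast
  show ?thesis
  proof (rule that[of "- X"])
    show "- X \<subseteq> K" "compact (- X)" "- X \<noteq> {}" "P (- X)" using X(1) mem by auto
    fix N assume N: "N \<subseteq> - X" "compact N" "N \<noteq> {}" "P N"
    then have "- N \<in> \<A>" using X(1) unfolding mem by auto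
    then show "N = - X" using X(2)[of "- N"] N(1) by auto
  qed
qed

text \<open>Associativity and continuity are required on the whole type and not just on
  \<open>T\<close>: \<open>usum\<close> has both for arbitrary predicates, which spares membership
  conditions.\<close>

locale compact_right_semigroup =
  fixes plus :: "'a::t2_space \<Rightarrow> 'a \<Rightarrow> 'a" (infixl "\<oplus>" 65) and T :: "'a set"
  assumes assoc: "(p \<oplus> q) \<oplus> r = p \<oplus> (q \<oplus> r)"
    and cont: "continuous_on UNIV (\<lambda>p. p \<oplus> q)"
    and compact: "compact T"
    and nonempty: "T \<noteq> {}"
    and closed: "p \<in> T \<Longrightarrow> q \<in> T \<Longrightarrow> p \<oplus> q \<in> T"
begin

text \<open>Equivalent to minimality among left ideals. In this form every member of
  \<open>M\<close> is \<open>t \<oplus> m\<close> for any prescribed \<open>m \<in> M\<close>, which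
  is how minimality gets used.\<close>

definition minimal_left_ideal :: "'a set \<Rightarrow> bool" where
  "minimal_left_ideal M \<longleftrightarrow> M \<noteq> {} \<and> M \<subseteq> T \<and> (\<forall>m\<in>M. (\<lambda>t. t \<oplus> m) ` T = M)"

lemma compact_translate: "compact N \<Longrightarrow> compact ((\<lambda>t. t \<oplus> x) ` N)"
  using cont[of x] by (meson compact_continuous_image continuous_on_subset subset_UNIV)

text \<open>By continuity \<open>T \<oplus> x\<close> is a compact left ideal. Take a minimal
  compact left ideal in it; for each member \<open>m\<close>, the compact left ideal
  \<open>T \<oplus> m\<close> lies inside and hence exhausts it.\<close>

lemma minimal_left_ideal_exists:
  assumes "x \<in> T"
  obtains M where "minimal_left_ideal M" "M \<subseteq> (\<lambda>t. t \<oplus> x) ` T"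
proof -
  define P where "P L \<longleftrightarrow> (\<forall>t\<in>T. \<forall>l\<in>L. t \<oplus> l \<in> L)" for L
  have translate: "P ((\<lambda>t. t \<oplus> m) ` T)" for m
    unfolding P_def by (auto simp: assoc[symmetric] closed intro!: imageI)
  obtain M where M: "M \<subseteq> (\<lambda>t. t \<oplus> x) ` T" "compact M" "M \<noteq> {}" "P M"
    and min: "\<And>N. N \<subseteq> M \<Longrightarrow> compact N \<Longrightarrow> N \<noteq> {} \<Longrightarrow> P N \<Longrightarrow> N = M"
  proof (rule compact_minimal_set[of "(\<lambda>t. t \<oplus> x) ` T" P])
    show "compact ((\<lambda>t. t \<oplus> x) ` T)" by (rule compact_translate[OF compact])
    show "(\<lambda>t. t \<oplus> x) ` T \<noteq> {}" using nonempty by auto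
    show "P ((\<lambda>t. t \<oplus> x) ` T)" by (rule translate)
    show "P (\<Inter>\<C>)" if "\<And>C. C \<in> \<C> \<Longrightarrow> P C" for \<C>
      using that unfolding P_def by blast
  qed blast
  have "(\<lambda>t. t \<oplus> m) ` T = M" if "m \<in> M" for m
  proof (rule min)
    show "(\<lambda>t. t \<oplus> m) ` T \<subseteq> M" using M(4) that by (auto simp: P_def)
  qed (use compact_translate[OF compact] nonempty translate in auto)
  moreover have "M \<subseteq> T" using M(1) closed assms by auto
  ultimately show ?thesis using M by (intro that[of M]) (simp_all add: minimal_left_ideal_def)
qed

lemma minimal_left_ideal_translate:
  "minimal_left_ideal M \<Longrightarrow> t \<in> T \<Longrightarrow> m \<in> M \<Longrightarrow> t \<oplus> m \<in> M"
  unfolding minimal_left_ideal_def by blast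

lemma minimal_left_ideal_compact: "minimal_left_ideal M \<Longrightarrow> compact M"
  unfolding minimal_left_ideal_def using compact_translate[OF compact] by (metis ex_in_conv)

text \<open>The Ellis-Numakura lemma. For \<open>e\<close> in a minimal compact subsemigroup
  \<open>M\<close>, minimality gives \<open>M \<oplus> e = M\<close>, so some
  \<open>t \<in> M\<close> satisfies \<open>t \<oplus> e = e\<close>. All such \<open>t\<close> form
  a compact subsemigroup, which is therefore \<open>M\<close> and contains \<open>e\<close>.\<close>

lemma idempotent_exists:
  assumes "compact N" "N \<noteq> {}" "\<And>p q. p \<in> N \<Longrightarrow> q \<in> N \<Longrightarrow> p \<oplus> q \<in> N"
  obtains e where "e \<in> N" "e \<oplus> e = e"
proof -
  define P where "P L \<longleftrightarrow> (\<forall>s\<in>L. \<forall>l\<in>L. s \<oplus> l \<in> L)" for L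
  obtain M where M: "M \<subseteq> N" "compact M" "M \<noteq> {}" "P M"
    and min: "\<And>N. N \<subseteq> M \<Longrightarrow> compact N \<Longrightarrow> N \<noteq> {} \<Longrightarrow> P N \<Longrightarrow> N = M"
  proof (rule compact_minimal_set[of N P])
    show "P N" using assms(3) by (auto simp: P_def)
    show "P (\<Inter>\<C>)" if "\<And>C. C \<in> \<C> \<Longrightarrow> P C" for \<C>
      using that unfolding P_def by blast
  qed (use assms in blast)+
  obtain e where e: "e \<in> M" using M(3) by auto
  have "(\<lambda>t. t \<oplus> e) ` M = M"
  proof (rule min)
    have mem: "s \<oplus> e \<in> M" if "s \<in> M" for s using M(4) e that by (auto simp: P_def)
    then show "(\<lambda>t. t \<oplus> e) ` M \<subseteq> M" by auto
    show "P ((\<lambda>t. t \<oplus> e) ` M)" unfolding P_def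
      using mem M(4) by (auto simp: P_def assoc[symmetric])
  qed (use compact_translate[OF M(2)] M(3) in auto)
  then have ne: "M \<inter> (\<lambda>t. t \<oplus> e) -` {e} \<noteq> {}"
  proof -
    have "e \<in> (\<lambda>t. t \<oplus> e) ` M" using e \<open>_ = M\<close> by simp
    then obtain t where "t \<in> M" "t \<oplus> e = e" by (metis imageE)
    then show ?thesis by auto
  qed
  have "closed ((\<lambda>t. t \<oplus> e) -` {e})"
    using cont by (intro closed_vimage) auto
  then have "M \<inter> (\<lambda>t. t \<oplus> e) -` {e} = M"
    using ne M(2,4) by (intro min) (auto simp: P_def assoc)
  then show ?thesis using that[of e] e M(1) by auto
qed

end

text \<open>An idempotent \<open>f\<close> of a minimal left ideal inside
  \<open>T \<oplus> q\<close> goes under each \<open>h i\<close> to an idempotent of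
  \<open>M'\<close>. So \<open>q \<oplus> f\<close> lies in the ideal and still has the value
  \<open>p\<close> under all \<open>h i\<close> at once.\<close>

lemma minimal_left_ideal_lift:
  fixes plus :: "'a::t2_space \<Rightarrow> 'a \<Rightarrow> 'a" (infixl "\<oplus>" 65)
    and plus' :: "'b::t2_space \<Rightarrow> 'b \<Rightarrow> 'b" (infixl "\<otimes>" 65)
  assumes "compact_right_semigroup (\<oplus>) T" "compact_right_semigroup (\<otimes>) T'"
    and h: "\<And>i p. p \<in> T \<Longrightarrow> h i p \<in> T'" "\<And>i p q. h i (p \<oplus> q) = h i p \<otimes> h i q"
    and M': "compact_right_semigroup.minimal_left_ideal (\<otimes>) T' M'" "p \<in> M'"
    and q: "q \<in> T" "\<And>i. h i q = p"
  shows "\<exists>M q'. compact_right_semigroup.minimal_left_ideal (\<oplus>) T M \<and> q' \<in> M \<and> (\<forall>i. h i q' = p)"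
proof -
  interpret T: compact_right_semigroup "(\<oplus>)" T by fact
  interpret T': compact_right_semigroup "(\<otimes>)" T' by fact
  obtain M where M: "T.minimal_left_ideal M" "M \<subseteq> (\<lambda>t. t \<oplus> q) ` T"
    using T.minimal_left_ideal_exists q(1) by blast
  have "M \<noteq> {}" "M \<subseteq> T" using M(1) unfolding T.minimal_left_ideal_def by auto
  then obtain f where f: "f \<in> M" "f \<oplus> f = f"
    using T.idempotent_exists[of M] T.minimal_left_ideal_compact[OF M(1)]
      T.minimal_left_ideal_translate[OF M(1)] by blast
  obtain r where r: "r \<in> T" "f = r \<oplus> q" using f(1) M(2) by auto
  have "h i (q \<oplus> f) = p" for i
  proof -
    have "h i f = h i r \<otimes> p" using r h q by auto
    then have "h i f \<in> M'" using M' r h(1) T'.minimal_left_ideal_translate by auto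
    then have "(\<lambda>t. t \<otimes> h i f) ` T' = M'" using M' unfolding T'.minimal_left_ideal_def by blast
    \<comment> \<open>An idempotent of a minimal left ideal is a right identity there:
      \<open>p\<close> is a left multiple of it, and it absorbs a second copy of itself.\<close>
    then obtain s where "p = s \<otimes> h i f" using M'(2) by blast
    moreover have "h i f \<otimes> h i f = h i f" using h(2)[of i f f] f(2) by simp
    ultimately have "p \<otimes> h i f = p" by (simp add: T'.assoc)
    then show ?thesis using h q by simp
  qed
  moreover have "q \<oplus> f \<in> M" using T.minimal_left_ideal_translate M(1) q f by blast
  ultimately show ?thesis using M(1) by blast
qed

section \<open>Ultrafilters near zero\<close>

lemma open_evaluation: "open U \<Longrightarrow> open {h :: 'a \<Rightarrow> 'b::topological_space. h x \<in> U}"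
  using open_vimage[of U "\<lambda>h::'a \<Rightarrow> 'b. h x"] by (simp add: vimage_def)

\<comment> \<open>The arities for \<open>t0_space\<close> and \<open>t1_space\<close> must come first: the ones that the library derives
   from its metric instance on countable domains would conflict with the \<open>t2_space\<close> instance.\<close>
instance "fun" :: (type, t0_space) t0_space
proof
  fix f g :: "'a \<Rightarrow> 'b"
  assume "f \<noteq> g"
  then obtain x where "f x \<noteq> g x" by auto
  then obtain U where "open U" "\<not> (f x \<in> U \<longleftrightarrow> g x \<in> U)" using separation_t0 by blast
  then show "\<exists>U. open U \<and> \<not> (f \<in> U \<longleftrightarrow> g \<in> U)"
    by (intro exI[of _ "{h. h x \<in> U}"]) (simp add: open_evaluation)
qed

instance "fun" :: (type, t1_space) t1_space
proof
  fix f g :: "'a \<Rightarrow> 'b"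
  assume "f \<noteq> g"
  then obtain x where "f x \<noteq> g x" by auto
  then obtain U where "open U" "f x \<in> U" "g x \<notin> U" using separation_t1 by blast
  then show "\<exists>U. open U \<and> f \<in> U \<and> g \<notin> U"
    by (intro exI[of _ "{h. h x \<in> U}"]) (simp add: open_evaluation)
qed

instance "fun" :: (type, t2_space) t2_space
proof
  fix f g :: "'a \<Rightarrow> 'b"
  assume "f \<noteq> g"
  then obtain x where "f x \<noteq> g x" by auto
  from hausdorff[OF this]
  obtain U V where "open U" "open V" "f x \<in> U" "g x \<in> V" "U \<inter> V = {}" by auto
  then show "\<exists>U V. open U \<and> open V \<and> f \<in> U \<and> g \<in> V \<and> U \<inter> V = {}"
    by (intro exI[of _ "{h. h x \<in> U}"] exI[of _ "{h. h x \<in> V}"]) (auto simp: open_evaluation)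
qed

text \<open>Tychonoff's theorem for copies of the finite space \<open>bool\<close>.\<close>

lemma compact_UNIV_predicates: "compact (UNIV :: ('a \<Rightarrow> bool) set)"
proof -
  have "compactin (product_topology (\<lambda>_::'a. euclidean :: bool topology) UNIV) (PiE UNIV (\<lambda>_. UNIV))"
    by (subst compactin_PiE) (auto simp: finite_imp_compact)
  then show ?thesis by (simp add: euclidean_product_topology PiE_UNIV_domain)
qed

text \<open>An ultrafilter on the whole type, as a Boolean homomorphism to \<open>bool\<close>. Each
  condition involves at most three coordinates, which makes the set of ultrafilters closed.\<close>

definition ultra :: "('a set \<Rightarrow> bool) \<Rightarrow> bool" where
  "ultra p \<longleftrightarrow> (\<forall>X. p (- X) \<longleftrightarrow> \<not> p X) \<and> (\<forall>X Y. p (X \<inter> Y) \<longleftrightarrow> p X \<and> p Y)"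

lemma ultra_Compl: "ultra p \<Longrightarrow> p (- X) \<longleftrightarrow> \<not> p X"
  and ultra_Int: "ultra p \<Longrightarrow> p (X \<inter> Y) \<longleftrightarrow> p X \<and> p Y"
  unfolding ultra_def by auto

lemma ultra_mono: "ultra p \<Longrightarrow> p X \<Longrightarrow> X \<subseteq> Y \<Longrightarrow> p Y"
  using ultra_Int[of p X Y] by (simp add: Int_absorb2)

lemma ultra_empty: "ultra p \<Longrightarrow> \<not> p {}"
  using ultra_Compl[of p "{}"] ultra_mono[of p "{}" UNIV] by auto

lemma ultra_UNIV: "ultra p \<Longrightarrow> p UNIV"
  using ultra_Compl[of p "{}"] ultra_empty[of p] by auto

lemma ultra_INT:
  assumes "ultra p" "finite F"
  shows "p (\<Inter>t\<in>F. D t) \<longleftrightarrow> (\<forall>t\<in>F. p (D t))"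
  using assms(2) by (induction F) (auto simp: assms(1) ultra_UNIV ultra_Int)

lemma ultra_UN: "ultra p \<Longrightarrow> finite F \<Longrightarrow> p (\<Union>t\<in>F. D t) \<longleftrightarrow> (\<exists>t\<in>F. p (D t))"
  using ultra_INT[of p F "\<lambda>t. - D t"] ultra_Compl[of p "\<Union>t\<in>F. D t"] ultra_Compl[of p]
  by auto

lemma ultra_eqI:
  assumes "ultra p" "ultra q" "\<And>X. p X \<Longrightarrow> q X"
  shows "p = q"
proof
  show "p X = q X" for X
    using assms(3)[of X] assms(3)[of "- X"] ultra_Compl[OF assms(1)] ultra_Compl[OF assms(2)] by blast
qed

definition near :: "'a::real_normed_vector set \<Rightarrow> real \<Rightarrow> 'a set" where
  "near S e = {x \<in> S. norm x < e}"

lemma near_mono: "d \<le> e \<Longrightarrow> near S d \<subseteq> near S e"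
  by (auto simp: near_def)

text \<open>Models \<open>zero_star S\<close> by ultrafilters on the whole type: containing the sets
  \<open>near S e\<close> they contain \<open>S\<close>, and so correspond to ultrafilters on
  \<open>S\<close>. Norm balls replace the neighborhoods of zero.\<close>

definition zero_ultras :: "'a::real_normed_vector set \<Rightarrow> ('a set \<Rightarrow> bool) set" where
  "zero_ultras S = {p. ultra p \<and> (\<forall>e>0. p (near S e))}"

lemma zero_ultrasD: "p \<in> zero_ultras S \<Longrightarrow> ultra p" "p \<in> zero_ultras S \<Longrightarrow> e > 0 \<Longrightarrow> p (near S e)"
  by (auto simp: zero_ultras_def)

lemma closed_eval: "closed {p :: 'a \<Rightarrow> bool. p X}" "closed {p :: 'a \<Rightarrow> bool. \<not> p X}"
proof -
  have eval: "continuous_on UNIV (\<lambda>p::'a \<Rightarrow> bool. p X)" by simp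
  have "closed ((\<lambda>p::'a \<Rightarrow> bool. p X) -` B)" for B
    by (rule closed_vimage[OF _ eval]) (simp add: closed_def open_discrete)
  from this[of "{True}"] this[of "{False}"]
  show "closed {p :: 'a \<Rightarrow> bool. p X}" "closed {p :: 'a \<Rightarrow> bool. \<not> p X}"
    by (simp_all add: vimage_def)
qed

lemma closed_ultra: "closed {p. ultra p}"
proof -
  have 1: "closed {p :: 'a set \<Rightarrow> bool. p (- X) \<longleftrightarrow> \<not> p X}" for X
  proof -
    have "{p :: 'a set \<Rightarrow> bool. p (- X) \<longleftrightarrow> \<not> p X} =
      ({p. p (- X)} \<inter> {p. \<not> p X}) \<union> ({p. \<not> p (- X)} \<inter> {p. p X})" by auto
    then show ?thesis by (simp add: closed_eval closed_Int closed_Un)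
  qed
  have 2: "closed {p :: 'a set \<Rightarrow> bool. p (X \<inter> Y) \<longleftrightarrow> p X \<and> p Y}" for X Y
  proof -
    have "{p :: 'a set \<Rightarrow> bool. p (X \<inter> Y) \<longleftrightarrow> p X \<and> p Y} =
      ({p. p (X \<inter> Y)} \<inter> {p. p X} \<inter> {p. p Y}) \<union> ({p. \<not> p (X \<inter> Y)} \<inter> ({p. \<not> p X} \<union> {p. \<not> p Y}))"
      by auto
    then show ?thesis by (simp add: closed_eval closed_Int closed_Un)
  qed
  show ?thesis unfolding ultra_def
    by (intro closed_Collect_conj closed_Collect_all 1 2)
qed

lemma zero_ultras_compact: "compact (zero_ultras S)"
proof -
  have "zero_ultras S = {p. ultra p} \<inter> (\<Inter>e\<in>{0<..}. {p. p (near S e)})"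
    by (auto simp: zero_ultras_def)
  then have "closed (zero_ultras S)"
    by (simp add: closed_ultra closed_eval closed_INT closed_Int)
  then show ?thesis using compact_Int_closed[OF compact_UNIV_predicates] by force
qed

text \<open>By compactness it suffices to satisfy finitely many conditions at a time, and the
  principal ultrafilter at a point of the finite intersection does that.\<close>

lemma zero_ultra_exists:
  assumes "\<And>F e. finite F \<Longrightarrow> F \<subseteq> \<D> \<Longrightarrow> e > 0 \<Longrightarrow> near S e \<inter> \<Inter>F \<noteq> {}"
  shows "\<exists>p\<in>zero_ultras S. \<forall>D\<in>\<D>. p D"
proof -
  define \<E> where "\<E> = \<D> \<union> near S ` {0<..}"
  have fip: "\<Inter>F \<noteq> {}" if F: "finite F" "F \<subseteq> \<E>" for F
  proof -
    have "F - \<D> \<subseteq> near S ` {0<..}" using F by (auto simp: \<E>_def)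
    then obtain E where E: "finite E" "E \<subseteq> {0<..}" "F - \<D> = near S ` E"
      using F finite_subset_image[of "F - \<D>" "near S" "{0<..}"] by blast
    \<comment> \<open>The least of finitely many radii; inserting \<open>1\<close> covers the case
      of empty \<open>E\<close>.\<close>
    define e where "e = Min (insert 1 E)"
    have e: "e > 0" using E by (auto simp: e_def)
    have "near S e \<subseteq> X" if "X \<in> F - \<D>" for X
    proof -
      have "X \<in> near S ` E" using that E(3) by simp
      then obtain d where "d \<in> E" "X = near S d" by auto
      moreover have "e \<le> d" using E \<open>d \<in> E\<close> by (simp add: e_def)
      ultimately show ?thesis using near_mono by metis
    qed
    then have "near S e \<inter> \<Inter>(F \<inter> \<D>) \<subseteq> \<Inter>F" by blast
    moreover have "near S e \<inter> \<Inter>(F \<inter> \<D>) \<noteq> {}" using assms[of "F \<inter> \<D>" e] F e by simp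
    ultimately show ?thesis by (metis bot.extremum_uniqueI)
  qed
  have "{p. ultra p} \<inter> \<Inter>((\<lambda>D. {p. p D}) ` \<E>) \<noteq> {}"
  proof (rule compact_imp_fip_image)
    show "compact {p :: 'a set \<Rightarrow> bool. ultra p}"
      using compact_Int_closed[OF compact_UNIV_predicates closed_ultra] by simp
    show "closed {p :: 'a set \<Rightarrow> bool. p D}" for D by (rule closed_eval)
    fix F assume "finite F" "F \<subseteq> \<E>"
    then obtain x where "x \<in> \<Inter>F" using fip by blast
    moreover have "ultra (\<lambda>X. x \<in> X)" by (auto simp: ultra_def)
    ultimately have "(\<lambda>X. x \<in> X) \<in> {p. ultra p} \<inter> (\<Inter>D\<in>F. {p. p D})" by auto
    then show "{p. ultra p} \<inter> (\<Inter>D\<in>F. {p. p D}) \<noteq> {}" by blast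
  qed
  then obtain p where "ultra p" "\<And>D. D \<in> \<E> \<Longrightarrow> p D" by auto
  then show ?thesis by (intro bexI[of _ p]) (auto simp: zero_ultras_def \<E>_def)
qed

section \<open>Addition of ultrafilters\<close>

definition usum :: "('a::plus set \<Rightarrow> bool) \<Rightarrow> ('a set \<Rightarrow> bool) \<Rightarrow> 'a set \<Rightarrow> bool" where
  "usum p q X \<longleftrightarrow> p {s. q {t. s + t \<in> X}}"

lemma usum_assoc:
  fixes p q r :: "'a::semigroup_add set \<Rightarrow> bool"
  shows "usum (usum p q) r = usum p (usum q r)"
  by (simp add: usum_def fun_eq_iff add.assoc)

text \<open>Coordinate \<open>X\<close> of \<open>usum p q\<close> is coordinate
  \<open>{s. q {t. s + t \<in> X}}\<close> of \<open>p\<close>, so for fixed \<open>q\<close> the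
  map only copies coordinates.\<close>

lemma usum_cont: "continuous_on UNIV (\<lambda>p. usum p q)"
  by (rule continuous_on_coordinatewise_then_product) (simp add: usum_def)

lemma usum_ultra:
  assumes "ultra p" "ultra q"
  shows "ultra (usum p q)"
  unfolding ultra_def usum_def
proof (intro conjI allI)
  fix X Y :: "'a set"
  have "{t. s + t \<in> - X} = - {t. s + t \<in> X}" for s by auto
  then have "{s. q {t. s + t \<in> - X}} = - {s. q {t. s + t \<in> X}}"
    by (auto simp: ultra_Compl[OF assms(2)])
  then show "p {s. q {t. s + t \<in> - X}} \<longleftrightarrow> \<not> p {s. q {t. s + t \<in> X}}"
    by (simp add: ultra_Compl[OF assms(1)])
  have "{t. s + t \<in> X \<inter> Y} = {t. s + t \<in> X} \<inter> {t. s + t \<in> Y}" for s by auto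
  then have "{s. q {t. s + t \<in> X \<inter> Y}} = {s. q {t. s + t \<in> X}} \<inter> {s. q {t. s + t \<in> Y}}"
    by (simp only: ultra_Int[OF assms(2)]) auto
  then show "p {s. q {t. s + t \<in> X \<inter> Y}} \<longleftrightarrow> p {s. q {t. s + t \<in> X}} \<and> p {s. q {t. s + t \<in> Y}}"
    by (simp only: ultra_Int[OF assms(1)])
qed

text \<open>Covers \<open>S\<close> and its power alike. The second assumption puts zero in the
  closure of \<open>S\<close>, so that ultrafilters near zero exist.\<close>

locale semigroup_near_zero =
  fixes S :: "'a::real_normed_vector set"
  assumes add_closed: "x \<in> S \<Longrightarrow> y \<in> S \<Longrightarrow> x + y \<in> S"
    and near_nonempty: "e > 0 \<Longrightarrow> near S e \<noteq> {}"
begin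

sublocale compact_right_semigroup usum "zero_ultras S"
proof
  show "zero_ultras S \<noteq> {}"
    using zero_ultra_exists[of "{}" S] near_nonempty by auto
  fix p q assume p: "p \<in> zero_ultras S" and q: "q \<in> zero_ultras S"
  have "usum p q (near S e)" if "e > 0" for e
  proof -
    \<comment> \<open>Each summand gets half of the radius, by the triangle inequality.\<close>
    have "q {t. s + t \<in> near S e}" if "s \<in> near S (e/2)" for s
    proof (rule ultra_mono)
      show "q (near S (e/2))" using q \<open>e > 0\<close> by (simp add: zero_ultrasD)
      show "near S (e/2) \<subseteq> {t. s + t \<in> near S e}"
        using that add_closed norm_add_less[of s "e/2" _ "e/2"] by (auto simp: near_def)
    qed (use q zero_ultrasD in auto)
    moreover have "p (near S (e/2))" using p \<open>e > 0\<close> by (simp add: zero_ultrasD)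
    ultimately show ?thesis
      unfolding usum_def by (meson CollectI p subsetI ultra_mono zero_ultrasD(1))
  qed
  then show "usum p q \<in> zero_ultras S"
    using usum_ultra p q by (auto simp: zero_ultras_def)
qed (auto simp: usum_assoc usum_cont zero_ultras_compact)

end

section \<open>Piecewise syndetic sets near zero\<close>

lemma near_nbhds_zero:
  assumes "e > 0"
  shows "near {0::'a::ordered_euclidean_space..} e \<in> nbhds_zero"
proof -
  have "near {0::'a..} e = {0..} \<inter> ball 0 e" by (auto simp: near_def)
  then have "openin (top_of_set {0..}) (near {0::'a..} e)" by (simp add: openin_open_Int)
  then show ?thesis
    using assms by (auto simp: nbhds_zero_def near_def)
qed

lemma nbhds_zero_near:
  assumes "U \<in> nbhds_zero"
  obtains e where "e > 0" "near {0..} e \<subseteq> U"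
proof -
  obtain O' where O': "openin (top_of_set {0..}) O'" "0 \<in> O'" "O' \<subseteq> U"
    using assms by (auto simp: nbhds_zero_def)
  then obtain e where "e > 0" "\<And>y. y \<in> {0..} \<Longrightarrow> dist y 0 < e \<Longrightarrow> y \<in> O'"
    unfolding openin_euclidean_subtopology_iff by blast
  then show ?thesis using O' by (intro that[of e]) (auto simp: near_def)
qed

text \<open>Compactness as a finite subcover: if no finite union of the \<open>D t\<close> contained
  a ball, some ultrafilter near zero would contain all their complements.\<close>

lemma (in semigroup_near_zero) zero_ultras_cover:
  assumes "\<And>r. r \<in> zero_ultras S \<Longrightarrow> \<exists>t\<in>I. r (D t)"
  obtains F e where "finite F" "F \<subseteq> I" "e > 0" "near S e \<subseteq> (\<Union>t\<in>F. D t)"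
proof (rule ccontr)
  assume "\<not> thesis"
  with that have no: "\<not> near S e \<subseteq> (\<Union>t\<in>F. D t)" if "finite F" "F \<subseteq> I" "e > 0" for F e
    using that by blast
  have fip: "near S e \<inter> \<Inter>F' \<noteq> {}" if F': "finite F'" "F' \<subseteq> (\<lambda>t. - D t) ` I" and e: "e > 0" for F' e
  proof -
    obtain F where F: "finite F" "F \<subseteq> I" "F' = (\<lambda>t. - D t) ` F"
      using finite_subset_image[OF F'] by auto
    obtain x where "x \<in> near S e" "x \<notin> (\<Union>t\<in>F. D t)" using no[OF F(1,2) e] by blast
    then have "x \<in> near S e \<inter> \<Inter>F'" using F(3) by auto
    then show ?thesis by blast
  qed
  have "\<exists>r\<in>zero_ultras S. \<forall>d\<in>(\<lambda>t. - D t) ` I. r d"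
    by (rule zero_ultra_exists) (rule fip)
  then obtain r where r: "r \<in> zero_ultras S" "\<And>t. t \<in> I \<Longrightarrow> r (- D t)" by auto
  then show False using assms[OF r(1)] ultra_Compl[OF zero_ultrasD(1)[OF r(1)]] by blast
qed

text \<open>The points \<open>x\<close> found for finite \<open>G\<close> are merged into one
  ultrafilter \<open>r\<close> that serves all \<open>g\<close> and \<open>n\<close>. A minimal left
  ideal inside the translates of \<open>r\<close> then has a member that contains
  \<open>B\<close>.\<close>

lemma piecewise_syndetic_imp_minimal:
  assumes S: "semigroup_near_zero S" "S \<subseteq> {0..}" and pws: "piecewise_syndetic_near_zero S B"
  obtains M p where "compact_right_semigroup.minimal_left_ideal usum (zero_ultras S) M" "p \<in> M" "p B"
proof -
  interpret semigroup_near_zero S by fact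
  obtain W F V where W: "local_base_zero W"
    and F: "\<And>n. finite (F n)" "\<And>n. F n \<subseteq> W n \<inter> S"
    and V: "\<And>n. V n \<in> nbhds_zero"
    and syn: "\<And>G O'. finite G \<Longrightarrow> G \<noteq> {} \<Longrightarrow> G \<subseteq> S \<Longrightarrow> O' \<in> nbhds_zero \<Longrightarrow>
      \<exists>x \<in> O' \<inter> S. \<forall>n. (\<lambda>g. g + x) ` (G \<inter> V n) \<subseteq> (\<Union>t\<in>F n. shift S t B)"
    using pws unfolding piecewise_syndetic_near_zero_def by metis
  define I where "I = {(n, g). g \<in> V n \<inter> S}"
  \<comment> \<open>\<open>D (n, g)\<close> collects the \<open>x\<close> that are good for one
    pair. The hypothesis says that finitely many of these sets always meet near zero.\<close>
  define D where "D = (\<lambda>(n, g). {x. \<exists>t\<in>F n. t + (g + x) \<in> B})"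
  have fip: "near S e \<inter> \<Inter>F' \<noteq> {}" if F': "finite F'" "F' \<subseteq> D ` I" and e: "e > 0" for F' e
  proof -
    obtain J where J: "finite J" "J \<subseteq> I" "F' = D ` J" using finite_subset_image[OF F'] by auto
    show ?thesis
    proof (cases "J = {}")
      case True
      then show ?thesis using J near_nonempty[OF e] by simp
    next
      case False
      have "snd ` J \<subseteq> S" using J(2) by (auto simp: I_def)
      then obtain x where x: "x \<in> near {0..} e \<inter> S"
        "\<forall>n. (\<lambda>g. g + x) ` (snd ` J \<inter> V n) \<subseteq> (\<Union>t\<in>F n. shift S t B)"
        using syn[of "snd ` J" "near {0..} e"] False J(1) near_nbhds_zero[OF e] by auto
      have "x \<in> D (n, g)" if "(n, g) \<in> J" for n g
      proof -
        have "g \<in> snd ` J \<inter> V n" using that J(2) by (force simp: I_def)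
        then have "g + x \<in> (\<Union>t\<in>F n. shift S t B)" using x(2) by blast
        then show ?thesis by (auto simp: D_def shift_def)
      qed
      then have "x \<in> near S e \<inter> \<Inter>F'" using x(1) J(3) by (auto simp: near_def)
      then show ?thesis by blast
    qed
  qed
  have "\<exists>r\<in>zero_ultras S. \<forall>d\<in>D ` I. r d"
    by (rule zero_ultra_exists) (rule fip)
  then obtain r where r: "r \<in> zero_ultras S" "\<And>j. j \<in> I \<Longrightarrow> r (D j)" by auto
  obtain M where M: "minimal_left_ideal M" "M \<subseteq> (\<lambda>t. usum t r) ` zero_ultras S"
    using minimal_left_ideal_exists[OF r(1)] by blast
  then obtain m where m: "m \<in> M" unfolding minimal_left_ideal_def by blast
  then have mz: "m \<in> zero_ultras S" using M(1) unfolding minimal_left_ideal_def by blast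
  obtain s where s: "s \<in> zero_ultras S" "m = usum s r" using m M(2) by blast
  \<comment> \<open>\<open>Y\<close> consists of the \<open>t\<close> with \<open>-t + B\<close> in
    \<open>m\<close>. An ultrafilter \<open>u\<close> containing \<open>Y\<close> gives
    \<open>usum u m\<close> containing \<open>B\<close>, so \<open>Y\<close> has to be shown to
    accumulate at zero.\<close>
  define Y where "Y = {t. m {y. t + y \<in> B}}"
  have FY: "F n \<inter> Y \<noteq> {}" for n
  proof -
    obtain d where d: "d > 0" "near {0..} d \<subseteq> V n" using nbhds_zero_near[OF V] by blast
    \<comment> \<open>For every small \<open>g\<close>, the \<open>x\<close> that \<open>g\<close>
      moves into the union of the \<open>-t + B\<close> over \<open>F n\<close> form a member of
      \<open>r\<close>. So the union is in \<open>usum s r = m\<close>, and with it one of its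
      finitely many parts.\<close>
    have "near S d \<subseteq> {g. r {x. g + x \<in> (\<Union>t\<in>F n. {y. t + y \<in> B})}}"
    proof
      fix g assume "g \<in> near S d"
      then have "(n, g) \<in> I" using d S(2) by (auto simp: I_def near_def)
      then have "r (D (n, g))" using r(2) by blast
      moreover have "D (n, g) = {x. g + x \<in> (\<Union>t\<in>F n. {y. t + y \<in> B})}" by (auto simp: D_def)
      ultimately show "g \<in> {g. r {x. g + x \<in> (\<Union>t\<in>F n. {y. t + y \<in> B})}}" by simp
    qed
    then have "m (\<Union>t\<in>F n. {y. t + y \<in> B})"
      unfolding s(2) usum_def
      by (rule ultra_mono[OF zero_ultrasD(1)[OF s(1)] zero_ultrasD(2)[OF s(1) d(1)]])
    then show ?thesis
      using ultra_UN[OF zero_ultrasD(1)[OF mz] F(1)] by (auto simp: Y_def)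
  qed
  have Y: "near S e \<inter> Y \<noteq> {}" if e: "e > 0" for e
  proof -
    obtain n where "W n \<subseteq> near {0..} e"
      using W near_nbhds_zero[OF e] unfolding local_base_zero_def by blast
    then have "F n \<subseteq> near S e" using F(2)[of n] by (auto simp: near_def)
    then show ?thesis using FY[of n] by blast
  qed
  have fip: "near S e \<inter> \<Inter>F' \<noteq> {}" if "F' \<subseteq> {Y}" "e > 0" for F' e
    using that Y[of e] near_nonempty[of e] subset_singletonD[of F' Y] by auto
  then have "\<exists>u\<in>zero_ultras S. \<forall>d\<in>{Y}. u d" by (intro zero_ultra_exists)
  then obtain u where u: "u \<in> zero_ultras S" "u Y" by auto
  then have "usum u m B" by (simp add: usum_def Y_def)
  moreover have "usum u m \<in> M" using minimal_left_ideal_translate[OF M(1) u(1) m] .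
  ultimately show ?thesis using that M(1) by blast
qed

text \<open>For \<open>r\<close> near zero, minimality gives \<open>q = usum s (usum r q)\<close>,
  so arbitrarily small \<open>t\<close> have \<open>-t + X\<close> in \<open>usum r q\<close>. By
  compactness finitely many \<open>t\<close> serve all \<open>r\<close> and their sets
  \<open>C t\<close> cover a ball; this yields \<open>F n\<close> and \<open>V n\<close>.\<close>

lemma minimal_imp_piecewise_syndetic:
  assumes S: "semigroup_near_zero S" "S \<subseteq> {0..}" "0 \<notin> S" and X: "X \<subseteq> S" "q X"
    and M: "compact_right_semigroup.minimal_left_ideal usum (zero_ultras S) M" "q \<in> M"
  shows "piecewise_syndetic_near_zero S X"
proof -
  interpret semigroup_near_zero S by fact
  define \<delta> where "\<delta> n = inverse (real (Suc n))" for n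
  have \<delta>: "\<delta> n > 0" for n by (simp add: \<delta>_def)
  \<comment> \<open>\<open>r (C t)\<close> says exactly that \<open>-t + X\<close> belongs to
    \<open>usum r q\<close>.\<close>
  define C where "C t = {g. q {y. t + (g + y) \<in> X}}" for t
  have q: "q \<in> zero_ultras S" using M unfolding minimal_left_ideal_def by blast
  have "\<exists>F e. finite F \<and> F \<noteq> {} \<and> F \<subseteq> near S (\<delta> n) \<and> e > 0 \<and> near S e \<subseteq> (\<Union>t\<in>F. C t)" for n
  proof -
    have cover: "\<exists>t\<in>near S (\<delta> n). r (C t)" if r: "r \<in> zero_ultras S" for r
    proof -
      have "usum r q \<in> M" using minimal_left_ideal_translate[OF M(1) r M(2)] .
      then have "(\<lambda>t. usum t (usum r q)) ` zero_ultras S = M"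
        using M(1) unfolding minimal_left_ideal_def by blast
      then obtain s where s: "s \<in> zero_ultras S" "q = usum s (usum r q)" using M(2) by blast
      have "s {t. r (C t)}"
      proof -
        have "usum s (usum r q) X" using X(2) s(2) by simp
        then show ?thesis by (simp add: usum_def C_def)
      qed
      then have "s (near S (\<delta> n) \<inter> {t. r (C t)})"
        using ultra_Int zero_ultrasD s(1) \<delta> by metis
      then have "near S (\<delta> n) \<inter> {t. r (C t)} \<noteq> {}"
        using ultra_empty zero_ultrasD(1) s(1) by metis
      then show ?thesis by blast
    qed
    obtain F e where "finite F" "F \<subseteq> near S (\<delta> n)" "e > 0" "near S e \<subseteq> (\<Union>t\<in>F. C t)"
      by (rule zero_ultras_cover[OF cover])
    moreover from this have "F \<noteq> {}" using near_nonempty[of e] by auto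
    ultimately show ?thesis by blast
  qed
  then obtain F e where F: "\<And>n. finite (F n)" "\<And>n. F n \<noteq> {}" "\<And>n. F n \<subseteq> near S (\<delta> n)"
    and e: "\<And>n. e n > 0" "\<And>n. near S (e n) \<subseteq> (\<Union>t\<in>F n. C t)" by metis
  define W where "W n = near {0::'a..} (\<delta> n)" for n
  \<comment> \<open>The bound \<open>e n\<close> keeps \<open>S \<inter> V n\<close> covered by the
    sets \<open>C t\<close>; the bound \<open>\<delta> n\<close> keeps \<open>V n\<close> inside
    \<open>W n\<close> and shrinks it to zero.\<close>
  define V where "V n = near {0::'a..} (min (e n) (\<delta> n))" for n
  have base: "local_base_zero W"
    unfolding local_base_zero_def
  proof (intro conjI allI ballI)
    have "\<delta> n \<le> \<delta> m" if "m \<le> n" for m n using that by (simp add: \<delta>_def)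
    then show "decseq W" unfolding decseq_def W_def using near_mono by blast
    show "W n \<in> nbhds_zero" for n unfolding W_def by (rule near_nbhds_zero[OF \<delta>])
    fix U :: "'a set" assume "U \<in> nbhds_zero"
    then obtain d where d: "d > 0" "near {0..} d \<subseteq> U" using nbhds_zero_near by blast
    obtain n where "\<delta> n < d" using reals_Archimedean[OF d(1)] by (auto simp: \<delta>_def)
    then have "W n \<subseteq> U" unfolding W_def using d(2) near_mono[of "\<delta> n" d] by force
    then show "\<exists>n. W n \<subseteq> U" by blast
  qed
  \<comment> \<open>Since \<open>0 \<notin> S\<close>, each \<open>g \<in> G\<close> lies in only finitely many \<open>V n\<close>,
     so only finitely many members of \<open>q\<close> have to be intersected.\<close>
  have syn: "\<exists>x \<in> O' \<inter> S. \<forall>n. (\<lambda>g. g + x) ` (G \<inter> V n) \<subseteq> (\<Union>t\<in>F n. shift S t X)"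
    if G: "finite G" "G \<subseteq> S" and O': "O' \<in> nbhds_zero" for G O'
  proof -
    obtain d where d: "d > 0" "near {0..} d \<subseteq> O'" using nbhds_zero_near[OF O'] by blast
    define J where "J = (SIGMA g:G. {n. g \<in> V n})"
    have "finite {n. g \<in> V n}" if "g \<in> G" for g
    proof -
      have "norm g > 0" using that G(2) S(3) by auto
      then obtain N where N: "\<delta> N < norm g" using reals_Archimedean[of "norm g"] by (auto simp: \<delta>_def)
      have "n < N" if "g \<in> V n" for n
      proof (rule ccontr)
        assume "\<not> n < N"
        then have "\<delta> n \<le> \<delta> N" by (simp add: \<delta>_def)
        then show False using N that by (simp add: V_def near_def)
      qed
      then show ?thesis using finite_subset[of "{n. g \<in> V n}" "{..<N}"] by auto
    qed
    then have J: "finite J" unfolding J_def using G(1) by auto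
    \<comment> \<open>\<open>E (g, n)\<close> is the requirement on \<open>x\<close> for one pair.
      Each is a member of \<open>q\<close>, so finitely many have a common solution near
      zero.\<close>
    define E where "E = (\<lambda>(g, n). {y. \<exists>t\<in>F n. t + (g + y) \<in> X})"
    have "q (E j)" if "j \<in> J" for j
    proof -
      obtain g n where j: "j = (g, n)" "g \<in> G" "g \<in> V n" using \<open>j \<in> J\<close> by (auto simp: J_def)
      then have "g \<in> near S (e n)" using G(2) by (auto simp: V_def near_def)
      then obtain t where t: "t \<in> F n" "q {y. t + (g + y) \<in> X}" using e(2)[of n] by (auto simp: C_def)
      then show ?thesis
        by (intro ultra_mono[OF zero_ultrasD(1)[OF q] t(2)]) (auto simp: E_def j)
    qed
    then have "q (near S d \<inter> (\<Inter>j\<in>J. E j))"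
      using ultra_Int ultra_INT J zero_ultrasD[OF q] d(1) by metis
    then have "near S d \<inter> (\<Inter>j\<in>J. E j) \<noteq> {}" using ultra_empty zero_ultrasD(1)[OF q] by metis
    then obtain x where x: "x \<in> near S d" "\<And>j. j \<in> J \<Longrightarrow> x \<in> E j" by blast
    have "x \<in> O' \<inter> S" using x(1) d(2) S(2) by (auto simp: near_def)
    moreover have "g + x \<in> (\<Union>t\<in>F n. shift S t X)" if "g \<in> G" "g \<in> V n" for g n
    proof -
      have "x \<in> E (g, n)" using x(2) that by (simp add: J_def)
      then show ?thesis using that(1) G(2) \<open>x \<in> O' \<inter> S\<close> add_closed by (auto simp: E_def shift_def)
    qed
    ultimately show ?thesis by blast
  qed
  have FW: "F n \<subseteq> W n \<inter> S" for n using F(3)[of n] S(2) by (auto simp: W_def near_def)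
  have V: "V n \<in> nbhds_zero" "V n \<subseteq> W n" for n
  proof -
    show "V n \<in> nbhds_zero"
      unfolding V_def by (rule near_nbhds_zero) (simp add: e(1) \<delta>)
    show "V n \<subseteq> W n"
      unfolding V_def W_def by (rule near_mono) simp
  qed
  show ?thesis
    unfolding piecewise_syndetic_near_zero_def
  proof (rule conjI[OF X(1)], rule exI[of _ W], rule conjI[OF base], rule exI[of _ F],
      rule exI[of _ V], intro conjI)
    show "\<forall>n. finite (F n) \<and> F n \<noteq> {} \<and> F n \<subseteq> W n \<inter> S" using F(1,2) FW by simp
    show "\<forall>n. V n \<in> nbhds_zero \<and> V n \<subseteq> W n" using V by simp
    show "\<forall>G O'. finite G \<and> G \<noteq> {} \<and> G \<subseteq> S \<and> O' \<in> nbhds_zero \<longrightarrow>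
        (\<exists>x \<in> O' \<inter> S. \<forall>n. (\<lambda>g. g + x) ` (G \<inter> V n) \<subseteq> (\<Union>t\<in>F n. shift S t X))"
      by (intro allI impI syn) simp_all
  qed
qed

section \<open>Matrices with nonnegative integer entries\<close>

lemma near_dense_nonempty:
  fixes S :: "'a::ordered_euclidean_space set"
  assumes "dense_subsemigroup S" "e > 0"
  shows "near S e \<noteq> {}"
proof -
  have "near {0::'a..} e = {0..} \<inter> ball 0 e" by (auto simp: near_def)
  then have "openin (top_of_set {0..}) (near {0::'a..} e)" by (simp add: openin_open_Int)
  moreover have "0 \<in> near {0::'a..} e" using assms(2) by (simp add: near_def)
  moreover have "0 \<in> top_of_set {0::'a..} closure_of S" using assms(1) by (simp add: dense_subsemigroup_def)
  ultimately obtain y where "y \<in> S" "y \<in> near {0..} e" by (metis in_closure_of)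
  then show ?thesis by (auto simp: near_def)
qed

text \<open>The bound \<open>e / CARD('v)\<close> on the coordinates keeps the l1 norm, which
  dominates the Euclidean norm, below \<open>e\<close>.\<close>

lemma cart_power_near:
  fixes x :: "real ^ 'v"
  assumes "x \<in> cart_power (S \<inter> {0<..<e / CARD('v)})"
  shows "x \<in> near (cart_power S) e"
proof -
  have x: "x $ i \<in> S" "\<bar>x $ i\<bar> < e / CARD('v)" for i
  proof -
    have "x $ i \<in> S \<inter> {0<..<e / CARD('v)}" using assms by (simp add: cart_power_def)
    then show "x $ i \<in> S" "\<bar>x $ i\<bar> < e / CARD('v)" by auto
  qed
  have "norm x \<le> (\<Sum>i\<in>UNIV. \<bar>x $ i\<bar>)" by (rule norm_le_l1_cart)
  also have "\<dots> < (\<Sum>i\<in>(UNIV::'v set). e / CARD('v))" by (rule sum_strict_mono) (auto simp: x)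
  also have "\<dots> = e" by simp
  finally show ?thesis using x(1) by (simp add: near_def cart_power_def)
qed

text \<open>\<open>S\<close> need not contain \<open>0\<close>, so terms with coefficient zero are
  dropped first. Some nonzero coefficient remains, and what is left is a nonempty sum of positive
  multiples.\<close>

lemma nat_combination_mem:
  fixes S :: "real set" and c :: "'v::finite \<Rightarrow> nat"
  assumes add: "\<And>x y. x \<in> S \<Longrightarrow> y \<in> S \<Longrightarrow> x + y \<in> S"
    and "c \<noteq> (\<lambda>_. 0)" and x: "\<And>j. x j \<in> S"
  shows "(\<Sum>j\<in>UNIV. real (c j) * x j) \<in> S"
proof -
  have mult: "real (Suc n) * s \<in> S" if "s \<in> S" for n s
  proof (induction n)
    case (Suc n)
    have "real (Suc (Suc n)) * s = s + real (Suc n) * s" by (simp add: algebra_simps)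
    then show ?case using add[OF that Suc] by metis
  qed (simp add: that)
  have sum: "(\<Sum>j\<in>J. real (c j) * x j) \<in> S" if "finite J" "J \<noteq> {}" "J \<subseteq> {j. c j \<noteq> 0}" for J
    using that
  proof (induction J rule: finite_ne_induct)
    case (singleton j)
    \<comment> \<open>\<open>mult\<close> speaks of \<open>Suc n\<close>, so a nonzero
      \<open>c j\<close> enters as \<open>Suc (c j - 1)\<close>.\<close>
    then show ?case using mult[OF x, of "c j - 1" j] by simp
  next
    case (insert j J)
    then show ?case using mult[OF x, of "c j - 1" j] add by simp
  qed
  have "(\<Sum>j\<in>UNIV. real (c j) * x j) = (\<Sum>j\<in>{j. c j \<noteq> 0}. real (c j) * x j)"
    by (rule sum.mono_neutral_right) auto
  moreover have "{j. c j \<noteq> 0} \<noteq> {}" using assms(2) by (auto simp: fun_eq_iff)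
  ultimately show ?thesis using sum[of "{j. c j \<noteq> 0}"] by simp
qed

theorem theorem3p19:
  fixes A :: "nat ^ 'v ^ 'u" and S :: "real set"
  assumes "\<forall>i. row i A \<noteq> 0"
    and "dense_subsemigroup S" and "S \<subseteq> {0<..}"
    and "\<forall>C. central_near_zero S C \<longrightarrow>
           (\<exists>x \<in> cart_power S. map_matrix real A *v x \<in> cart_power C)"
    and "\<forall>\<epsilon>>0. \<forall>s \<in> S \<inter> {0<..<\<epsilon>}.
           \<exists>x \<in> cart_power (S \<inter> {0<..<\<epsilon>}). map_matrix real A *v x = vec s"
  shows "\<forall>B. piecewise_syndetic_near_zero S B \<longrightarrow>
           piecewise_syndetic_near_zero (cart_power S :: (real ^ 'v) set)
             {x \<in> cart_power S. map_matrix real A *v x \<in> cart_power B}"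
proof (intro allI impI)
  fix B assume pws: "piecewise_syndetic_near_zero S B"
  define Sv where "Sv = (cart_power S :: (real ^ 'v) set)"
  define f where "f i x = (map_matrix real A *v x) $ i" for i and x :: "real ^ 'v"
  have add: "x + y \<in> S" if "x \<in> S" "y \<in> S" for x y
    using assms(2) that by (simp add: dense_subsemigroup_def)
  have small: "\<exists>s\<in>S. 0 < s \<and> s < d" if "d > 0" for d
    using near_dense_nonempty[OF assms(2) that] assms(3) by (auto simp: near_def)
  interpret S: semigroup_near_zero S
    by unfold_locales (use add near_dense_nonempty[OF assms(2)] in auto)
  interpret Sv: semigroup_near_zero Sv
  proof
    show "x + y \<in> Sv" if "x \<in> Sv" "y \<in> Sv" for x y
      using that add by (simp add: Sv_def cart_power_def)
    show "near Sv e \<noteq> {}" if "e > 0" for e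
    proof -
      have "e / CARD('v) > 0" using that by simp
      from small[OF this] obtain s where "s \<in> S" "0 < s" "s < e / CARD('v)" by auto
      \<comment> \<open>Constant vectors with a small entry from \<open>S\<close> are points of the
        power near zero.\<close>
      then have "vec s \<in> cart_power (S \<inter> {0<..<e / CARD('v)})" by (simp add: cart_power_def)
      then show ?thesis unfolding Sv_def using cart_power_near by blast
    qed
  qed
  have f_add: "f i (x + y) = f i x + f i y" for i x y
    by (simp add: f_def matrix_vector_right_distrib)
  have f_mem: "f i x \<in> S" if "x \<in> Sv" for i x
  proof -
    \<comment> \<open>A nonzero row has a nonzero entry, so its combinations stay in
      \<open>S\<close>.\<close>
    have "(\<lambda>j. A $ i $ j) \<noteq> (\<lambda>_. 0)"
      using assms(1) by (metis row_def vec_lambda_unique zero_index)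
    then have "(\<Sum>j\<in>UNIV. real (A $ i $ j) * x $ j) \<in> S"
      using that by (intro nat_combination_mem add) (auto simp: Sv_def cart_power_def)
    then show ?thesis by (simp add: f_def matrix_vector_mult_def map_matrix_def)
  qed
  \<comment> \<open>The image ultrafilter of \<open>p\<close> under the \<open>i\<close>-th row;
    additivity of \<open>f i\<close> makes \<open>h i\<close> a homomorphism for
    \<open>usum\<close>.\<close>
  define h where "h i p X = p {x. f i x \<in> X}" for i and p :: "(real ^ 'v) set \<Rightarrow> bool" and X
  have h_usum: "h i (usum p q) = usum (h i p) (h i q)" for i p q
    by (simp add: h_def usum_def f_add fun_eq_iff)
  have h_ultra: "ultra (h i p)" if "ultra p" for i p
  proof -
    have "{x. f i x \<in> - X} = - {x. f i x \<in> X}" "{x. f i x \<in> X \<inter> Y} = {x. f i x \<in> X} \<inter> {x. f i x \<in> Y}"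
      for X Y by auto
    then show ?thesis
      unfolding ultra_def h_def by (simp only: ultra_Compl[OF that] ultra_Int[OF that]) simp
  qed
  have h_zero: "h i p \<in> zero_ultras S" if p: "p \<in> zero_ultras Sv" for i p
  proof -
    have "h i p (near S e)" if "e > 0" for e
    proof -
      \<comment> \<open>A bound on the operator norm: the ball of radius \<open>e / K\<close> is
        mapped into the ball of radius \<open>e\<close>.\<close>
      obtain K where K: "K > 0" "\<And>x. norm (map_matrix real A *v x) \<le> norm x * K"
        using bounded_linear.pos_bounded[OF matrix_vector_mul_bounded_linear] by blast
      have "near Sv (e / K) \<subseteq> {x. f i x \<in> near S e}"
      proof
        fix x assume x: "x \<in> near Sv (e / K)"
        have "norm (f i x) \<le> norm x * K" unfolding f_def using Finite_Cartesian_Product.norm_nth_le K(2) order_trans by blast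
        also have "\<dots> < e" using x K(1) by (simp add: near_def field_simps)
        finally show "x \<in> {x. f i x \<in> near S e}" using x f_mem by (simp add: near_def)
      qed
      then show ?thesis
        unfolding h_def using p zero_ultrasD \<open>e > 0\<close> K(1) ultra_mono by (metis divide_pos_pos)
    qed
    then show ?thesis using h_ultra p by (simp add: zero_ultras_def)
  qed
  have S0: "S \<subseteq> {0..}" using assms(3) by force
  obtain M' p where M': "S.minimal_left_ideal M'" "p \<in> M'" "p B"
    using piecewise_syndetic_imp_minimal[OF S.semigroup_near_zero_axioms S0 pws] by blast
  have p: "p \<in> zero_ultras S" using M' unfolding S.minimal_left_ideal_def by blast
  \<comment> \<open>A member \<open>X\<close> of \<open>p\<close> contains arbitrarily small
    \<open>s\<close>. Hypothesis (2) solves the system for the constant vector \<open>s\<close> with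
    small \<open>x\<close>, so all rows take the same value \<open>s \<in> X\<close>.\<close>
  have diag: "near Sv e \<inter> {x. \<forall>i. f i x \<in> X} \<noteq> {}" if "p X" "e > 0" for X e
  proof -
    let ?d = "e / CARD('v)"
    have "?d > 0" using that by simp
    then have "p (X \<inter> near S ?d)" using that ultra_Int zero_ultrasD p by metis
    then have "X \<inter> near S ?d \<noteq> {}" using ultra_empty zero_ultrasD(1) p by metis
    then obtain s where s: "s \<in> X" "s \<in> S \<inter> {0<..<?d}" using assms(3) by (force simp: near_def)
    then obtain x where "x \<in> cart_power (S \<inter> {0<..<?d})" "map_matrix real A *v x = vec s"
      using assms(5) \<open>?d > 0\<close> by blast
    then have "x \<in> near Sv e \<inter> {x. \<forall>i. f i x \<in> X}"
      using cart_power_near[of x S e] s(1) by (simp add: Sv_def f_def)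
    then show ?thesis by blast
  qed
  \<comment> \<open>\<open>X \<mapsto> {x. \<forall>i. f i x \<in> X}\<close> commutes with
    intersections, so finite families reduce to \<open>diag\<close>.\<close>
  have "near Sv e \<inter> \<Inter>F \<noteq> {}"
    if F: "finite F" "F \<subseteq> (\<lambda>X. {x. \<forall>i. f i x \<in> X}) ` {X. p X}" and e: "e > 0" for F e
  proof -
    obtain G where G: "finite G" "G \<subseteq> {X. p X}" "F = (\<lambda>X. {x. \<forall>i. f i x \<in> X}) ` G"
      using finite_subset_image[OF F] by auto
    have "p (\<Inter>X\<in>G. X)" using G ultra_INT[OF zero_ultrasD(1)[OF p] G(1), of "\<lambda>X. X"] by auto
    from diag[OF this e] show ?thesis using G(3) by auto
  qed
  then have "\<exists>q\<in>zero_ultras Sv. \<forall>d\<in>(\<lambda>X. {x. \<forall>i. f i x \<in> X}) ` {X. p X}. q d"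
    by (rule zero_ultra_exists)
  then obtain q where q: "q \<in> zero_ultras Sv" "\<And>X. p X \<Longrightarrow> q {x. \<forall>i. f i x \<in> X}" by auto
  have hq: "h i q = p" for i
  proof (rule ultra_eqI[symmetric])
    show "h i q X" if "p X" for X
      unfolding h_def by (rule ultra_mono[OF zero_ultrasD(1)[OF q(1)] q(2)[OF that]]) auto
  qed (rule zero_ultrasD(1)[OF p] h_ultra[OF zero_ultrasD(1)[OF q(1)]])+
  \<comment> \<open>\<open>q\<close> itself need not lie in a minimal left ideal; it is replaced by
    an ultrafilter that does and has the same images.\<close>
  have "\<exists>M q'. Sv.minimal_left_ideal M \<and> q' \<in> M \<and> (\<forall>i. h i q' = p)"
  proof (rule minimal_left_ideal_lift)
    show "compact_right_semigroup usum (zero_ultras Sv)" "compact_right_semigroup usum (zero_ultras S)"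
      by unfold_locales
    show "h i p \<in> zero_ultras S" if "p \<in> zero_ultras Sv" for i p using that by (rule h_zero)
    show "h i (usum p q) = usum (h i p) (h i q)" for i p q by (rule h_usum)
  qed (fact M'(1) M'(2) q(1) hq)+
  then obtain M q' where M: "Sv.minimal_left_ideal M" "q' \<in> M" "\<And>i. h i q' = p" by auto
  have q': "q' \<in> zero_ultras Sv" using M unfolding Sv.minimal_left_ideal_def by blast
  \<comment> \<open>The ball, of any radius, forces membership in \<open>Sv\<close>; there are
    finitely many rows to intersect over.\<close>
  have "q' (near Sv 1 \<inter> (\<Inter>i. {x. f i x \<in> B}))"
  proof -
    have "q' {x. f i x \<in> B}" for i using M(3)[of i] M'(3) by (simp add: h_def fun_eq_iff)
    then show ?thesis
      using zero_ultrasD(2)[OF q', of 1] ultra_Int[OF zero_ultrasD(1)[OF q']]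
        ultra_INT[OF zero_ultrasD(1)[OF q'] finite, of "\<lambda>i. {x. f i x \<in> B}"] by simp
  qed
  then have "q' {x \<in> cart_power S. map_matrix real A *v x \<in> cart_power B}"
    by (rule ultra_mono[OF zero_ultrasD(1)[OF q']])
      (auto simp: near_def Sv_def f_def cart_power_def)
  \<comment> \<open>All coordinates are positive. That \<open>0\<close> is not in \<open>Sv\<close>
    ensures that each point lies in only finitely many of the shrinking neighborhoods.\<close>
  moreover have "0 \<notin> Sv" "Sv \<subseteq> {0..}"
    using assms(3) by (auto simp: Sv_def cart_power_def less_eq_vec_def less_imp_le subset_iff)
  ultimately have "piecewise_syndetic_near_zero Sv {x \<in> cart_power S. map_matrix real A *v x \<in> cart_power B}"
    using minimal_imp_piecewise_syndetic[OF Sv.semigroup_near_zero_axioms _ _ _ _ M(1,2)]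
    by (auto simp: Sv_def)
  then show "piecewise_syndetic_near_zero (cart_power S :: (real ^ 'v) set)
      {x \<in> cart_power S. map_matrix real A *v x \<in> cart_power B}"
    by (simp add: Sv_def)
qed

end
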